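(* Let $f\in L^1([-\pi,\pi]^d)$ with $f=\mathrm{Re}(f)+\mathbf{i}\,\mathrm{Im}(f)$, where $\mathrm{Re}(f)$ and $\mathrm{Im}(f)$ are real-valued functions with $\mathrm{Re}(f)$ essentially positive, and let $T_n[f]\in\mathbb{R}^{n\times n}$ be the multilevel Toeplitz matrix generated by $f$. Let $\mathcal{H}([f])=(T_n[f]+T_n[f]^{\top})/2$, and let $\mathcal{P}\in\mathbb{R}^{n\times n}$ be a symmetric positive definite matrix for which there are positive numbers $\check{c},\hat{c}$ with $\check{c}\le\lambda_k(\mathcal{P}^{-1}\mathcal{H}([f]))\le\hat{c}$ for $k=1,\dots,n$. Then the eigenvalues of $\mathcal{P}^{-1}Y_nT_n[f]$ lie in $$[-\hat{c}(1+\epsilon),-\check{c}]\cup[\check{c},\hat{c}(1+\epsilon)]$$ for some $\epsilon$ with $$\epsilon<\operatorname*{ess\,sup}_{\boldsymbol{\theta}\in[-\pi,\pi]^d}\left|\frac{\mathrm{Im}(f)(\boldsymbol{\theta})}{\mathrm{Re}(f)(\boldsymbol{\theta})}\right|.$$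
   Context: Functions $f\in L^1([-\pi,\pi]^d)$ are complex-valued, Lebesgue integrable and periodically extended to $\mathbb{R}^d$. For $\mathbf{n}=(n_1,\dots,n_d)$ with positive integer entries, $n=n_1n_2\cdots n_d$, the multilevel Toeplitz matrix generated by $f$ is $T_n[f]=\sum_{|j_1|<n_1}\cdots\sum_{|j_d|<n_d}J_{n_1}^{j_1}\otimes\cdots\otimes J_{n_d}^{j_d}\,a_{(j_1,\dots,j_d)}$, where $a_{(\mathbf{j})}=\frac{1}{(2\pi)^d}\int_{[-\pi,\pi]^d}f(\boldsymbol{\theta})e^{\mathbf{i}\langle\mathbf{j},\boldsymbol{\theta}\rangle}\,d\boldsymbol{\theta}$, $\mathbf{i}^2=-1$, and $J_m^j$ is the $m\times m$ matrix whose $(l,h)$ entry is $1$ if $l-h=j$ and $0$ otherwise. $\otimes$ is the Kronecker product. $Y_m$ is the $m\times m$ anti-identity matrix ($[Y_m]_{j,k}=1$ iff $j+k=m+1$, else $0$) and $Y_n=Y_{n_1}\otimes\cdots\otimes Y_{n_d}$. "Essentially positive" means positive almost everywhere. $\lambda_k(\cdot)$, $k=1,\dots,n$, denote the eigenvalues of an $n\times n$ matrix.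
   Formalization: If Im(f)=0 almost everywhere, the ess sup is 0 and the strict bound on ε can fail (d=1, n=1, f=1, P=1, č=ĉ=1: eigenvalue 1 but ε<0 makes both intervals empty); in that case only, ε=0 is also allowed. *)

theory Defs
  imports
    "HOL-Probability.Essential_Supremum"
    "Jordan_Normal_Form.Spectral_Radius"
    "Jordan_Normal_Form.Gauss_Jordan_Elimination"
begin

text \<open>
  Points of \<open>\<real>\<^sup>d\<close> are functions on \<open>{..<d}\<close>, since the order of the coordinates matters for
  the Kronecker products. The product of the Borel measures has to be completed in order to
  obtain Lebesgue measurability. Only the values of \<open>f\<close> on the cube enter any definition
  below, so the periodic extension of \<open>f\<close> need not be represented.
\<close>

definition cube_measure :: "nat \<Rightarrow> (nat \<Rightarrow> real) measure" where
  "cube_measure d =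
     restrict_space (completion (\<Pi>\<^sub>M i\<in>{..<d}. lborel)) (\<Pi>\<^sub>E i\<in>{..<d}. {-pi..pi})"

text \<open>The sign in the exponent is positive, contrary to the usual Fourier convention.\<close>

definition fourier_coeff :: "nat \<Rightarrow> ((nat \<Rightarrow> real) \<Rightarrow> complex) \<Rightarrow> int list \<Rightarrow> complex" where
  "fourier_coeff d f js =
     1 / of_real ((2 * pi) ^ d) *
     (LINT \<theta>|cube_measure d. f \<theta> * exp (\<i> * of_real (\<Sum>k<d. of_int (js ! k) * \<theta> k)))"

definition kronecker :: "'a::semiring_1 mat \<Rightarrow> 'a mat \<Rightarrow> 'a mat" where
  "kronecker A B =
     mat (dim_row A * dim_row B) (dim_col A * dim_col B)
       (\<lambda>(r, c). A $$ (r div dim_row B, c div dim_col B) * B $$ (r mod dim_row B, c mod dim_col B))"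

definition kronecker_list :: "'a::semiring_1 mat list \<Rightarrow> 'a mat" where
  "kronecker_list As = foldr kronecker As (1\<^sub>m 1)"

definition shift_mat :: "nat \<Rightarrow> int \<Rightarrow> 'a::semiring_1 mat" where
  "shift_mat m j = mat m m (\<lambda>(l, h). if int l - int h = j then 1 else 0)"

text \<open>
  The sum over all \<open>js\<close> with \<open>\<bar>j\<^sub>i\<bar> < n\<^sub>i\<close> is taken entrywise, because the type of matrices
  of arbitrary dimensions carries no additive monoid structure.
\<close>

definition multilevel_toeplitz :: "nat list \<Rightarrow> ((nat \<Rightarrow> real) \<Rightarrow> complex) \<Rightarrow> complex mat" where
  "multilevel_toeplitz ns f =
     mat (prod_list ns) (prod_list ns)
       (\<lambda>(l, h). \<Sum>js \<in> {js. list_all2 (\<lambda>j m. \<bar>j\<bar> < int m) js ns}.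
          kronecker_list (map2 shift_mat ns js) $$ (l, h) * fourier_coeff (length ns) f js)"

text \<open>Indices start at \<open>0\<close>, so \<open>j + k = m + 1\<close> becomes \<open>j + k + 1 = m\<close>.\<close>

definition anti_identity :: "nat \<Rightarrow> 'a::semiring_1 mat" where
  "anti_identity m = mat m m (\<lambda>(j, k). if j + k + 1 = m then 1 else 0)"

definition multilevel_anti_identity :: "nat list \<Rightarrow> 'a::semiring_1 mat" where
  "multilevel_anti_identity ns = kronecker_list (map anti_identity ns)"

definition sym_part :: "real mat \<Rightarrow> real mat" where
  "sym_part A = (1 / 2) \<cdot>\<^sub>m (A + transpose_mat A)"

definition sym_pos_def :: "nat \<Rightarrow> real mat \<Rightarrow> bool" where
  "sym_pos_def n A \<longleftrightarrow>
     A \<in> carrier_mat n n \<and> transpose_mat A = A \<and>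
     (\<forall>v \<in> carrier_vec n. v \<noteq> 0\<^sub>v n \<longrightarrow> 0 < scalar_prod v (A *\<^sub>v v))"

definition inverse_mat :: "real mat \<Rightarrow> real mat" where
  "inverse_mat A = the (mat_inverse A)"

text \<open>Eigenvalues of real matrices are a priori complex.\<close>

definition complex_spectrum :: "real mat \<Rightarrow> complex set" where
  "complex_spectrum A = spectrum (map_mat complex_of_real A)"

end

theory Submission
  imports Defs
begin

text \<open>
  Let \<open>H\<close> and \<open>S\<close> be the symmetric and skew parts of \<open>T\<close>. Since \<open>Y T Y\<close> is the transpose of
  \<open>T\<close>, the matrix \<open>Y\<close> commutes with \<open>H\<close>. If \<open>Y T x = \<lambda> P x\<close> and \<open>H z = S x\<close>, then
  \<open>u = Y (x + z)\<close> satisfies \<open>H u = \<lambda> P x\<close>, and \<open>\<langle>u, H u\<rangle> = \<langle>x, H x\<rangle> + \<langle>z, H z\<rangle>\<close> because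
  \<open>\<langle>x, S x\<rangle> = 0\<close>. With \<open>c_min P \<le> H \<le> c_max P\<close> and the Cauchy-Schwarz inequality, this gives
  \<open>c_min \<le> \<bar>\<lambda>\<bar>\<close>. If \<open>M\<close> is the essential supremum of \<open>\<bar>Im f / Re f\<bar>\<close>, then integrating \<open>f\<close>
  against squared moduli of trigonometric polynomials yields \<open>\<langle>z, H z\<rangle> \<le> M\<^sup>2 \<langle>x, H x\<rangle>\<close>, so
  \<open>\<bar>\<lambda>\<bar> \<le> c_max sqrt (1 + M\<^sup>2)\<close>. Strictness is free: \<open>sqrt (1 + M\<^sup>2) - 1 < M\<close> for
  \<open>0 < M < \<infinity>\<close>, and for \<open>M = \<infinity>\<close> it suffices that the spectrum is finite.
\<close>

unbundle no vec_syntax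

subsection \<open>Quadratic forms and symmetric pencils\<close>

definition bil :: "real mat \<Rightarrow> real vec \<Rightarrow> real vec \<Rightarrow> real" where
  "bil A x y = scalar_prod x (A *\<^sub>v y)"

lemma bil_sum:
  assumes "A \<in> carrier_mat n n" "x \<in> carrier_vec n" "y \<in> carrier_vec n"
  shows "bil A x y = (\<Sum>i<n. \<Sum>j<n. x $ i * A $$ (i, j) * y $ j)"
  using assms unfolding bil_def scalar_prod_def
  by (auto simp: scalar_prod_def sum_distrib_left mult.assoc lessThan_atLeast0 intro!: sum.cong)

lemma bil_lin:
  assumes A: "A \<in> carrier_mat n n"
    and x: "x \<in> carrier_vec n" and y: "y \<in> carrier_vec n" and z: "z \<in> carrier_vec n"
  shows bil_add_left: "bil A (x + y) z = bil A x z + bil A y z"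
    and bil_add_right: "bil A x (y + z) = bil A x y + bil A x z"
    and bil_smult_left: "bil A (t \<cdot>\<^sub>v x) y = t * bil A x y"
    and bil_smult_right: "bil A x (t \<cdot>\<^sub>v y) = t * bil A x y"
  using assms
  by (simp_all add: bil_sum[OF A] algebra_simps sum.distrib sum_distrib_left)

lemma bil_mat_lin:
  assumes A: "A \<in> carrier_mat n n" and B: "B \<in> carrier_mat n n"
    and x: "x \<in> carrier_vec n" and y: "y \<in> carrier_vec n"
  shows bil_add_mat: "bil (A + B) x y = bil A x y + bil B x y"
    and bil_smult_mat: "bil (t \<cdot>\<^sub>m A) x y = t * bil A x y"
    and bil_transpose: "bil (transpose_mat A) x y = bil A y x"
proof -
  show "bil (A + B) x y = bil A x y + bil B x y" "bil (t \<cdot>\<^sub>m A) x y = t * bil A x y"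
    using assms by (simp_all add: bil_sum[of _ n] algebra_simps sum.distrib sum_distrib_left)
  have "bil (transpose_mat A) x y = (\<Sum>i<n. \<Sum>j<n. x $ i * A $$ (j, i) * y $ j)"
    using assms by (simp add: bil_sum[of _ n])
  also have "\<dots> = bil A y x"
    using assms by (subst sum.swap) (simp add: bil_sum[of _ n] mult.assoc mult.commute[of "x $ _"] mult.left_commute)
  finally show "bil (transpose_mat A) x y = bil A y x" .
qed

lemma transpose_mat_smult: "transpose_mat (t \<cdot>\<^sub>m A) = t \<cdot>\<^sub>m transpose_mat A"
  by (rule eq_matI) auto

lemma bil_bounded:
  assumes A: "A \<in> carrier_mat n n"
  obtains C where "0 < C" "\<And>x. x \<in> carrier_vec n \<Longrightarrow> \<bar>bil A x x\<bar> \<le> C * scalar_prod x x"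
proof
  \<comment> \<open>The sum of the absolute entries already bounds the form, because each product of
    two coordinates is at most \<open>scalar_prod x x\<close>. The extra \<open>1\<close> keeps the
    constant positive, so that it may serve as a divisor.\<close>
  let ?C = "1 + (\<Sum>i<n. \<Sum>j<n. \<bar>A $$ (i, j)\<bar>)"
  show "0 < ?C" by (smt (verit) sum_nonneg abs_ge_zero)
  fix x :: "real vec" assume x: "x \<in> carrier_vec n"
  let ?q = "scalar_prod x x"
  have q: "?q = (\<Sum>i<n. (x $ i)\<^sup>2)"
    using x by (simp add: scalar_prod_def power2_eq_square lessThan_atLeast0)
  have q0: "0 \<le> ?q" unfolding q by (intro sum_nonneg) simp
  have le: "(x $ i)\<^sup>2 \<le> ?q" if "i < n" for i
    unfolding q using that by (intro member_le_sum) auto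
  have xx: "\<bar>x $ i\<bar> * \<bar>x $ j\<bar> \<le> ?q" if "i < n" "j < n" for i j
  proof -
    have "0 \<le> (\<bar>x $ i\<bar> - \<bar>x $ j\<bar>)\<^sup>2" by simp
    then show ?thesis using le[OF that(1)] le[OF that(2)]
      by (simp add: power2_diff)
  qed
  have "\<bar>bil A x x\<bar> \<le> (\<Sum>i<n. \<Sum>j<n. \<bar>A $$ (i, j)\<bar> * ?q)"
    unfolding bil_sum[OF A x x]
  proof (intro order_trans[OF sum_abs] sum_mono)
    fix i j assume ij: "i \<in> {..<n}" "j \<in> {..<n}"
    then show "\<bar>x $ i * A $$ (i, j) * x $ j\<bar> \<le> \<bar>A $$ (i, j)\<bar> * ?q"
      using mult_left_mono[OF xx[of i j], of "\<bar>A $$ (i, j)\<bar>"] by (simp add: abs_mult ac_simps)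
  qed
  also have "\<dots> \<le> ?C * ?q" using q0 by (simp add: algebra_simps sum_distrib_left)
  finally show "\<bar>bil A x x\<bar> \<le> ?C * ?q" .
qed

section \<open>Positive semidefinite forms and coercivity\<close>

definition psd :: "nat \<Rightarrow> real mat \<Rightarrow> bool" where
  "psd n A \<longleftrightarrow> A \<in> carrier_mat n n \<and> transpose_mat A = A \<and> (\<forall>x \<in> carrier_vec n. 0 \<le> bil A x x)"

lemma bil_commute:
  assumes "A \<in> carrier_mat n n" "transpose_mat A = A" "x \<in> carrier_vec n" "y \<in> carrier_vec n"
  shows "bil A x y = bil A y x"
  using bil_transpose[OF assms(1,1,3,4)] assms(2) by simp

lemma bil_add_smult:
  assumes A: "A \<in> carrier_mat n n" "transpose_mat A = A"
    and xy: "x \<in> carrier_vec n" "y \<in> carrier_vec n"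
  shows "bil A (x + t \<cdot>\<^sub>v y) (x + t \<cdot>\<^sub>v y) = bil A x x + 2 * t * bil A x y + t\<^sup>2 * bil A y y"
proof -
  note l = bil_lin[OF A(1)]
  have ty: "t \<cdot>\<^sub>v y \<in> carrier_vec n" "x + t \<cdot>\<^sub>v y \<in> carrier_vec n" using xy by auto
  show ?thesis
    by (simp only: l(1)[OF xy(1) ty(1) ty(2)] l(2)[OF xy(1) xy(1) ty(1)] l(2)[OF ty(1) xy(1) ty(1)]
        l(3)[OF xy(2) ty(1) xy(1)] l(3)[OF xy(2) xy(1) xy(1)]
        l(4)[OF xy(1) xy(2) xy(1)] l(4)[OF xy(2) xy(2) xy(1)] bil_commute[OF A xy(2,1)])
      (simp add: algebra_simps power2_eq_square)
qed

text \<open>For \<open>c > 0\<close> the claim is the value at the minimiser \<open>- b / c\<close>.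
  A negative \<open>c\<close> is impossible, and \<open>c = 0\<close> forces
  \<open>b = 0\<close>.\<close>

lemma quadratic_nonneg_imp_discriminant:
  fixes a b c :: real
  assumes "\<And>t. 0 \<le> a + 2 * t * b + t\<^sup>2 * c"
  shows "b\<^sup>2 \<le> a * c"
proof (cases "c = 0")
  case True
  have "b = 0"
  proof (rule ccontr)
    assume "b \<noteq> 0"
    \<comment> \<open>At this \<open>t\<close> the affine function \<open>a + 2 * t * b\<close>
      equals \<open>- 1\<close>.\<close>
    then show False using assms[of "- (a + 1) / (2 * b)"] True by (simp add: field_simps)
  qed
  then show ?thesis using True by simp
next
  case False
  have c: "0 < c"
  proof (rule ccontr)
    assume "\<not> 0 < c"
    with False have c: "c < 0" by simp
    \<comment> \<open>The choice gives \<open>s * c = - \<bar>a\<bar> - 1 + c\<close>, and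
      \<open>s \<ge> 1\<close> makes \<open>s^2 * c\<close> at most that. Using both
      \<open>s\<close> and \<open>- s\<close> eliminates the linear term.\<close>
    define s where "s = (\<bar>a\<bar> + 1) / \<bar>c\<bar> + 1"
    have "1 \<le> s" by (simp add: s_def)
    then have "s \<le> s\<^sup>2" using self_le_power[of s 2] by simp
    then have "s\<^sup>2 * c \<le> s * c" using c by (simp add: mult_right_mono_neg)
    also have "s * c = - \<bar>a\<bar> - 1 + c" using c by (simp add: s_def field_simps abs_if)
    finally have "a + s\<^sup>2 * c < 0" using c by linarith
    moreover have "0 \<le> a + 2 * s * b + s\<^sup>2 * c" "0 \<le> a - 2 * s * b + s\<^sup>2 * c"
      using assms[of s] assms[of "- s"] by simp_all
    ultimately show False by linarith
  qed
  have "0 \<le> a + 2 * (- b / c) * b + (- b / c)\<^sup>2 * c" by (rule assms)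
  also have "\<dots> = a - b\<^sup>2 / c" using c by (simp add: field_simps power2_eq_square)
  finally show ?thesis using c by (simp add: field_simps)
qed

text \<open>The form is nonnegative along the line \<open>x + t y\<close>. The discriminant argument
  also covers directions with \<open>bil A y y = 0\<close>.\<close>

lemma psd_Cauchy_Schwarz:
  assumes "psd n A" and xy: "x \<in> carrier_vec n" "y \<in> carrier_vec n"
  shows "(bil A x y)\<^sup>2 \<le> bil A x x * bil A y y"
proof (rule quadratic_nonneg_imp_discriminant)
  fix t
  have A: "A \<in> carrier_mat n n" "transpose_mat A = A" using assms(1) by (auto simp: psd_def)
  have "0 \<le> bil A (x + t \<cdot>\<^sub>v y) (x + t \<cdot>\<^sub>v y)" using assms by (auto simp: psd_def)
  then show "0 \<le> bil A x x + 2 * t * bil A x y + t\<^sup>2 * bil A y y"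
    by (simp add: bil_add_smult[OF A xy])
qed

text \<open>An injective square matrix has nonzero determinant and is a unit of the matrix ring, so
  \<open>mat_inverse\<close> returns \<open>Some\<close>. This gives \<open>inverse_mat\<close> its
  meaning for positive definite matrices.\<close>

lemma injective_mat_inverse:
  fixes A :: "'a :: field mat"
  assumes A: "A \<in> carrier_mat n n"
    and inj: "\<And>x. x \<in> carrier_vec n \<Longrightarrow> A *\<^sub>v x = 0\<^sub>v n \<Longrightarrow> x = 0\<^sub>v n"
  shows "the (mat_inverse A) \<in> carrier_mat n n"
    and "A * the (mat_inverse A) = 1\<^sub>m n" and "the (mat_inverse A) * A = 1\<^sub>m n"
proof -
  have "det A \<noteq> 0" using inj det_0_iff_vec_prod_zero_field[OF A] by auto
  then have "A \<in> Units (ring_mat TYPE('a) n n)" by (rule det_non_zero_imp_unit[OF A])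
  then obtain B where "mat_inverse A = Some B" using mat_inverse(1)[OF A] by fastforce
  with mat_inverse(2)[OF A this] show "the (mat_inverse A) \<in> carrier_mat n n"
    and "A * the (mat_inverse A) = 1\<^sub>m n" and "the (mat_inverse A) * A = 1\<^sub>m n" by auto
qed

lemma injective_mat_solve:
  fixes A :: "'a :: field mat"
  assumes A: "A \<in> carrier_mat n n"
    and inj: "\<And>x. x \<in> carrier_vec n \<Longrightarrow> A *\<^sub>v x = 0\<^sub>v n \<Longrightarrow> x = 0\<^sub>v n"
    and w: "w \<in> carrier_vec n"
  obtains z where "z \<in> carrier_vec n" "A *\<^sub>v z = w"
proof
  let ?B = "the (mat_inverse A)"
  note B = injective_mat_inverse[OF A inj]
  show "?B *\<^sub>v w \<in> carrier_vec n" using B(1) w by auto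
  show "A *\<^sub>v (?B *\<^sub>v w) = w" using B A w by (metis assoc_mult_mat_vec one_mult_mat_vec)
qed

text \<open>The inverse replaces a compactness argument. With \<open>y\<close> the preimage of
  \<open>x\<close> under \<open>A\<close>, \<open>scalar_prod x x\<close> equals
  \<open>bil A x y\<close>. Cauchy-Schwarz for \<open>A\<close> and a bound on the form of the
  inverse then give the constant.\<close>

lemma psd_injective_coercive:
  assumes psd: "psd n A"
    and inj: "\<And>x. x \<in> carrier_vec n \<Longrightarrow> A *\<^sub>v x = 0\<^sub>v n \<Longrightarrow> x = 0\<^sub>v n"
  obtains c where "0 < c" "\<And>x. x \<in> carrier_vec n \<Longrightarrow> c * scalar_prod x x \<le> bil A x x"
proof -
  have A: "A \<in> carrier_mat n n" "transpose_mat A = A" using psd by (auto simp: psd_def)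
  let ?B = "the (mat_inverse A)"
  note B = injective_mat_inverse[OF A(1) inj]
  obtain C where C: "0 < C" "\<And>x. x \<in> carrier_vec n \<Longrightarrow> \<bar>bil ?B x x\<bar> \<le> C * scalar_prod x x"
    using bil_bounded[OF B(1)] by blast
  show thesis
  proof
    show "0 < 1 / C" using C by simp
    fix x :: "real vec" assume x: "x \<in> carrier_vec n"
    let ?y = "?B *\<^sub>v x" and ?q = "scalar_prod x x"
    have y: "?y \<in> carrier_vec n" using B(1) x by auto
    have Ay: "A *\<^sub>v ?y = x" using B A x by (metis assoc_mult_mat_vec one_mult_mat_vec)
    have q0: "0 \<le> ?q" unfolding scalar_prod_def by (intro sum_nonneg) simp
    have yy: "bil A ?y ?y \<le> C * ?q"
    proof -
      have "bil A ?y ?y = scalar_prod ?y x" by (simp add: bil_def Ay)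
      also have "\<dots> = bil ?B x x" unfolding bil_def using x y by (simp add: comm_scalar_prod)
      finally show ?thesis using C(2)[OF x] by simp
    qed
    have "?q\<^sup>2 = (bil A x ?y)\<^sup>2" by (simp add: bil_def Ay)
    also have "\<dots> \<le> bil A x x * bil A ?y ?y" by (rule psd_Cauchy_Schwarz[OF psd x y])
    also have "\<dots> \<le> bil A x x * (C * ?q)"
      using psd x yy by (intro mult_left_mono) (auto simp: psd_def)
    finally have "?q * ?q \<le> (C * bil A x x) * ?q" by (simp add: power2_eq_square ac_simps)
    moreover have "0 \<le> bil A x x" using psd x by (auto simp: psd_def)
    ultimately have "?q \<le> C * bil A x x"
      using q0 C(1) by (cases "?q = 0") auto
    then show "1 / C * ?q \<le> bil A x x" using C(1) by (simp add: field_simps)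
  qed
qed

lemma sym_pos_def_psd: "sym_pos_def n P \<Longrightarrow> psd n P"
proof -
  assume P: "sym_pos_def n P"
  have "0 \<le> bil P x x" if "x \<in> carrier_vec n" for x
  proof (cases "x = 0\<^sub>v n")
    case True then show ?thesis using P by (auto simp: sym_pos_def_def bil_def)
  next
    case False then show ?thesis using P that by (force simp: sym_pos_def_def bil_def)
  qed
  with P show ?thesis by (auto simp: psd_def sym_pos_def_def)
qed

lemma sym_pos_def_pos: "sym_pos_def n P \<Longrightarrow> x \<in> carrier_vec n \<Longrightarrow> x \<noteq> 0\<^sub>v n \<Longrightarrow> 0 < bil P x x"
  by (simp add: sym_pos_def_def bil_def)

lemma sym_pos_def_inj:
  assumes "sym_pos_def n P" "x \<in> carrier_vec n" "P *\<^sub>v x = 0\<^sub>v n"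
  shows "x = 0\<^sub>v n"
  using sym_pos_def_pos[OF assms(1,2)] assms(2,3) by (force simp: bil_def)

text \<open>A positive semidefinite nonsingular form is coercive, so the set of \<open>t\<close> with
  \<open>t P \<le> H\<close> can only end at a generalised eigenvalue.\<close>
lemma pencil_lower_bound:
  assumes H: "H \<in> carrier_mat n n" "transpose_mat H = H" and P: "sym_pos_def n P"
    and noev: "\<And>t x. t < c \<Longrightarrow> x \<in> carrier_vec n \<Longrightarrow> H *\<^sub>v x = t \<cdot>\<^sub>v (P *\<^sub>v x) \<Longrightarrow> x = 0\<^sub>v n"
    and x: "x \<in> carrier_vec n"
  shows "c * bil P x x \<le> bil H x x"
proof -
  note P0 = sym_pos_def_psd[OF P]
  have Pc: "P \<in> carrier_mat n n" "transpose_mat P = P" using P0 by (auto simp: psd_def)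
  obtain CP where CP: "0 < CP" "\<And>x. x \<in> carrier_vec n \<Longrightarrow> \<bar>bil P x x\<bar> \<le> CP * scalar_prod x x"
    using bil_bounded[OF Pc(1)] by blast
  obtain CH where CH: "0 < CH" "\<And>x. x \<in> carrier_vec n \<Longrightarrow> \<bar>bil H x x\<bar> \<le> CH * scalar_prod x x"
    using bil_bounded[OF H(1)] by blast
  obtain cP where cP: "0 < cP" "\<And>x. x \<in> carrier_vec n \<Longrightarrow> cP * scalar_prod x x \<le> bil P x x"
    using psd_injective_coercive[OF P0 sym_pos_def_inj[OF P]] by blast
  \<comment> \<open>The cap \<open>t \<le> c\<close> keeps \<open>S\<close> bounded above even in
    dimension \<open>0\<close>, where the inequality between the forms holds for every
    \<open>t\<close>.\<close>
  define S where "S = {t. t \<le> c \<and> (\<forall>x \<in> carrier_vec n. t * bil P x x \<le> bil H x x)}"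
  have Pn: "0 \<le> bil P x x" if "x \<in> carrier_vec n" for x using P0 that by (auto simp: psd_def)
  \<comment> \<open>For very negative \<open>t\<close>, coercivity of \<open>P\<close> outweighs the
    bound on \<open>H\<close>.\<close>
  have "min c (- CH / cP) \<in> S"
    unfolding S_def
  proof (intro CollectI conjI ballI)
    fix x :: "real vec" assume x: "x \<in> carrier_vec n"
    have "min c (- CH / cP) * bil P x x \<le> (- CH / cP) * bil P x x"
      using Pn[OF x] by (intro mult_right_mono) auto
    also have "\<dots> \<le> - CH * scalar_prod x x"
      using mult_left_mono[OF cP(2)[OF x], of CH] CH(1) cP(1) by (simp add: field_simps)
    also have "\<dots> \<le> bil H x x" using CH(2)[OF x] by simp
    finally show "min c (- CH / cP) * bil P x x \<le> bil H x x" .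
  qed simp
  then have ne: "S \<noteq> {}" by auto
  have bdd: "bdd_above S" by (auto simp: S_def)
  define m where "m = Sup S"
  have mc: "m \<le> c" unfolding m_def using ne by (intro cSup_least) (auto simp: S_def)
  \<comment> \<open>The supremum is itself admissible, being at most every quotient
    \<open>bil H x x / bil P x x\<close> with positive denominator.\<close>
  have m: "m * bil P x x \<le> bil H x x" if x: "x \<in> carrier_vec n" for x
  proof (cases "bil P x x = 0")
    case True
    then show ?thesis using ne x by (auto simp: S_def)
  next
    case False
    with Pn[OF x] have p: "0 < bil P x x" by simp
    have "m \<le> bil H x x / bil P x x"
      unfolding m_def using ne x p by (intro cSup_least) (auto simp: S_def field_simps)
    then show ?thesis using p by (simp add: field_simps)
  qed
  have "m = c"
  proof (rule ccontr)
    assume "m \<noteq> c"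
    with mc have mc: "m < c" by simp
    let ?A = "H + (- m) \<cdot>\<^sub>m P"
    have mP: "(- m) \<cdot>\<^sub>m P \<in> carrier_mat n n" using Pc by simp
    have bA: "bil ?A x y = bil H x y - m * bil P x y"
      if "x \<in> carrier_vec n" "y \<in> carrier_vec n" for x y
      using bil_add_mat[OF H(1) mP that] bil_smult_mat[OF Pc(1,1) that] by simp
    have psd: "psd n ?A"
      unfolding psd_def
    proof (intro conjI ballI)
      show "?A \<in> carrier_mat n n" using H mP by simp
      show "transpose_mat ?A = ?A"
        using H(2) Pc(2) H(1) Pc(1) by (simp add: transpose_add[OF H(1) mP] transpose_mat_smult)
      show "0 \<le> bil ?A x x" if "x \<in> carrier_vec n" for x using bA[OF that that] m[OF that] by simp
    qed
    have inj: "x = 0\<^sub>v n" if x: "x \<in> carrier_vec n" and "?A *\<^sub>v x = 0\<^sub>v n" for x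
    proof (rule noev[OF mc x])
      have e: "H *\<^sub>v x + ((- m) \<cdot>\<^sub>m P) *\<^sub>v x = 0\<^sub>v n"
        using that H mP by (simp add: add_mult_distrib_mat_vec[of _ n n])
      show "H *\<^sub>v x = m \<cdot>\<^sub>v (P *\<^sub>v x)"
      proof (rule eq_vecI)
        fix i assume i: "i < dim_vec (m \<cdot>\<^sub>v (P *\<^sub>v x))"
        then have i: "i < n" using Pc by simp
        have "(H *\<^sub>v x + ((- m) \<cdot>\<^sub>m P) *\<^sub>v x) $ i = 0" using e i by simp
        then show "(H *\<^sub>v x) $ i = (m \<cdot>\<^sub>v (P *\<^sub>v x)) $ i"
          using i H Pc x by (simp add: row_smult)
      qed (use H Pc in auto)
    qed
    obtain a where a: "0 < a" "\<And>x. x \<in> carrier_vec n \<Longrightarrow> a * scalar_prod x x \<le> bil ?A x x"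
      using psd_injective_coercive[OF psd inj] by blast
    \<comment> \<open>Coercivity of \<open>H - m P\<close> leaves room to raise \<open>m\<close> by
      \<open>a / CP\<close>, which contradicts that \<open>m\<close> is the supremum.\<close>
    have "min c (m + a / CP) \<in> S"
      unfolding S_def
    proof (intro CollectI conjI ballI)
      fix x :: "real vec" assume x: "x \<in> carrier_vec n"
      have "min c (m + a / CP) * bil P x x \<le> (m + a / CP) * bil P x x"
        using Pn[OF x] by (intro mult_right_mono) auto
      also have "a / CP * bil P x x \<le> a * scalar_prod x x"
        using mult_left_mono[OF CP(2)[OF x], of a] a(1) CP(1) Pn[OF x] by (simp add: field_simps)
      then have "(m + a / CP) * bil P x x \<le> bil H x x"
        using a(2)[OF x] bA[OF x x] by (simp add: algebra_simps)
      finally show "min c (m + a / CP) * bil P x x \<le> bil H x x" .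
    qed simp
    then have "min c (m + a / CP) \<le> m" unfolding m_def by (intro cSup_upper bdd)
    moreover have "0 < a / CP" using a(1) CP(1) by simp
    ultimately show False using mc by linarith
  qed
  with m[OF x] show ?thesis by simp
qed

text \<open>Negating \<open>H\<close> negates the generalised eigenvalues, so this is the lower
  bound for \<open>- H\<close> and \<open>- c\<close>.\<close>

lemma pencil_upper_bound:
  assumes H: "H \<in> carrier_mat n n" "transpose_mat H = H" and P: "sym_pos_def n P"
    and noev: "\<And>t x. c < t \<Longrightarrow> x \<in> carrier_vec n \<Longrightarrow> H *\<^sub>v x = t \<cdot>\<^sub>v (P *\<^sub>v x) \<Longrightarrow> x = 0\<^sub>v n"
    and x: "x \<in> carrier_vec n"
  shows "bil H x x \<le> c * bil P x x"
proof -
  let ?H = "(- 1) \<cdot>\<^sub>m H"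
  have H': "?H \<in> carrier_mat n n" "transpose_mat ?H = ?H" using H by (auto simp: transpose_mat_smult)
  have Pc: "P \<in> carrier_mat n n" using P by (simp add: sym_pos_def_def)
  have "- c * bil P x x \<le> bil ?H x x"
  proof (rule pencil_lower_bound[OF H' P _ x])
    fix t and y :: "real vec"
    assume t: "t < - c" and y: "y \<in> carrier_vec n" and e: "?H *\<^sub>v y = t \<cdot>\<^sub>v (P *\<^sub>v y)"
    have "H *\<^sub>v y = (- t) \<cdot>\<^sub>v (P *\<^sub>v y)"
    proof (rule eq_vecI)
      fix i assume "i < dim_vec ((- t) \<cdot>\<^sub>v (P *\<^sub>v y))"
      then have i: "i < n" using Pc by simp
      have "(?H *\<^sub>v y) $ i = (t \<cdot>\<^sub>v (P *\<^sub>v y)) $ i" using e by simp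
      then show "(H *\<^sub>v y) $ i = ((- t) \<cdot>\<^sub>v (P *\<^sub>v y)) $ i"
        using i H Pc y by (simp add: row_smult)
    qed (use H Pc in auto)
    with noev[of "- t" y] t y show "y = 0\<^sub>v n" by simp
  qed
  then show ?thesis using bil_smult_mat[OF H(1,1) x x, of "-1"] by simp
qed

subsection \<open>Entries of multilevel Toeplitz matrices\<close>

lemma kronecker_list_Cons: "kronecker_list (A # As) = kronecker A (kronecker_list As)"
  by (simp add: kronecker_list_def)

lemma kronecker_list_Nil: "kronecker_list [] = 1\<^sub>m 1"
  by (simp add: kronecker_list_def)

lemma div_mod_less_factors:
  fixes r m q :: nat
  assumes "r < m * q"
  shows "r div q < m" "r mod q < q"
proof -
  have "0 < q" using assms by (cases q) auto
  then show "r mod q < q" by simp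
  show "r div q < m" using assms by (simp add: less_mult_imp_div_less)
qed

text \<open>Complementing an index complements its quotient and its remainder separately, because no
  carry occurs. This drives both the product formula for anti-identities and the reversal of
  digits.\<close>

lemma mixed_radix_complement:
  fixes r c m q :: nat
  assumes "r < m * q" "c < m * q"
  shows "r div q + c div q + 1 = m \<and> r mod q + c mod q + 1 = q \<longleftrightarrow> r + c + 1 = m * q"
proof -
  define r1 r0 c1 c0 where d: "r1 = r div q" "r0 = r mod q" "c1 = c div q" "c0 = c mod q"
  have r: "r = r1 * q + r0" and c: "c = c1 * q + c0" by (simp_all add: d)
  have l: "r0 < q" "c0 < q" using div_mod_less_factors[OF assms(1)] div_mod_less_factors[OF assms(2)]
    by (simp_all add: d)
  have "r1 + c1 + 1 = m \<and> r0 + c0 + 1 = q" if e: "r + c + 1 = m * q"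
  proof -
    have s: "(r1 + c1) * q + (r0 + c0 + 1) = m * q" using e r c by (simp add: algebra_simps)
    have "(r0 + c0 + 1) mod q = 0"
      using arg_cong[OF s, of "\<lambda>k. k mod q"] by (metis mod_mult_self2_is_0 mod_mult_self3)
    then have "q dvd r0 + c0 + 1" by auto
    then obtain k where k: "r0 + c0 + 1 = q * k" by (elim dvdE)
    \<comment> \<open>A positive multiple of \<open>q\<close> below \<open>2 q\<close> must be
      \<open>q\<close> itself.\<close>
    moreover have "r0 + c0 + 1 < q * 2" using l by linarith
    ultimately have "k < 2" "k \<noteq> 0" by (auto intro: ccontr)
    then have "k = 1" by simp
    with k have 1: "r0 + c0 + 1 = q" by simp
    then have "(r1 + c1 + 1) * q = m * q" using s by (simp add: algebra_simps)
    then have "r1 + c1 + 1 = m" using l(1) by (simp only: mult_cancel2) linarith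
    with 1 show ?thesis by simp
  qed
  moreover have "r + c + 1 = m * q" if "r1 + c1 + 1 = m" "r0 + c0 + 1 = q"
    using that r c by (auto simp: algebra_simps)
  ultimately show ?thesis by (auto simp: d)
qed

text \<open>By \<open>mixed_radix_complement\<close>, reversing every level reverses the combined
  index. The empty product fits, since the \<open>1\<close>-by-\<open>1\<close> identity is its own
  reversal.\<close>

lemma multilevel_anti_identity_eq:
  "multilevel_anti_identity ns = (anti_identity (prod_list ns) :: 'a :: semiring_1 mat)"
proof (induction ns)
  case Nil
  show ?case
    by (rule eq_matI) (auto simp: multilevel_anti_identity_def kronecker_list_Nil anti_identity_def)
next
  case (Cons m ns)
  have "multilevel_anti_identity (m # ns) =
      kronecker (anti_identity m) (anti_identity (prod_list ns) :: 'a mat)"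
    using Cons by (simp add: multilevel_anti_identity_def kronecker_list_Cons)
  also have "\<dots> = anti_identity (m * prod_list ns)"
  proof (rule eq_matI)
    fix r c
    assume "r < dim_row (anti_identity (m * prod_list ns) :: 'a mat)"
      "c < dim_col (anti_identity (m * prod_list ns) :: 'a mat)"
    then have "r < m * prod_list ns" "c < m * prod_list ns" by (simp_all add: anti_identity_def)
    then show "kronecker (anti_identity m) (anti_identity (prod_list ns) :: 'a mat) $$ (r, c) =
        anti_identity (m * prod_list ns) $$ (r, c)"
      using div_mod_less_factors[of r m "prod_list ns"] div_mod_less_factors[of c m "prod_list ns"]
        mixed_radix_complement[of r m "prod_list ns" c]
      by (auto simp: kronecker_def anti_identity_def)
  qed (auto simp: kronecker_def anti_identity_def)
  finally show ?case by simp
qed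

text \<open>Mixed radix expansion, most significant digit first, as in the index order of
  \<open>kronecker\<close>. The leading digit is not reduced, so the intended range is
  \<open>l < prod_list ns\<close>. Integer digits allow signed differences.\<close>

fun digits :: "nat list \<Rightarrow> nat \<Rightarrow> int list" where
  "digits [] l = []"
| "digits (m # ns) l = int (l div prod_list ns) # digits ns (l mod prod_list ns)"

lemma length_digits [simp]: "length (digits ns l) = length ns"
  by (induction ns arbitrary: l) auto

lemma digit_differences_bounded:
  assumes "l < prod_list ns" "h < prod_list ns"
  shows "list_all2 (\<lambda>j m. \<bar>j\<bar> < int m) (map2 (-) (digits ns l) (digits ns h)) ns"
  using assms
proof (induction ns arbitrary: l h)
  case (Cons m ns)
  then show ?case
    using div_mod_less_factors[of l m "prod_list ns"] div_mod_less_factors[of h m "prod_list ns"]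
    by auto
qed simp

lemma dim_kronecker_shift:
  "length js = length ns \<Longrightarrow>
    dim_row (kronecker_list (map2 shift_mat ns js) :: 'a :: semiring_1 mat) = prod_list ns \<and>
    dim_col (kronecker_list (map2 shift_mat ns js) :: 'a mat) = prod_list ns"
  by (induction js ns rule: list_induct2)
    (auto simp: kronecker_list_Nil kronecker_list_Cons kronecker_def shift_mat_def)

text \<open>An entry of a Kronecker product is the product of the factor entries at the digits, and
  each shift matrix tests one digit difference.\<close>

lemma kronecker_shift_entry:
  assumes "length js = length ns" "l < prod_list ns" "h < prod_list ns"
  shows "kronecker_list (map2 shift_mat ns js) $$ (l, h) =
    (if js = map2 (-) (digits ns l) (digits ns h) then 1 else 0 :: 'a :: semiring_1)"
  using assms
proof (induction js ns arbitrary: l h rule: list_induct2)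
  case Nil
  then show ?case by (simp add: kronecker_list_Nil)
next
  case (Cons j js m ns)
  let ?q = "prod_list ns"
  have lh: "l < m * ?q" "h < m * ?q" using Cons.prems by simp_all
  note b = div_mod_less_factors[OF lh(1)] div_mod_less_factors[OF lh(2)]
  show ?case
    using Cons.IH[OF b(2,4)] b lh dim_kronecker_shift[OF Cons.hyps, where 'a = 'a]
    by (auto simp: kronecker_list_Cons kronecker_def shift_mat_def)
qed

text \<open>Sums over infinite sets are \<open>0\<close> by convention, so finiteness is required to
  evaluate the sum that defines the Toeplitz entries.\<close>

lemma finite_shift_indices: "finite {js. list_all2 (\<lambda>j m. \<bar>j\<bar> < int m) js ns}"
proof (induction ns)
  case (Cons m ns)
  have "{js. list_all2 (\<lambda>j m. \<bar>j\<bar> < int m) js (m # ns)} =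
      (\<lambda>(j, js). j # js) ` ({- int m<..<int m} \<times> {js. list_all2 (\<lambda>j m. \<bar>j\<bar> < int m) js ns})"
    by (auto simp: list_all2_Cons2 image_iff)
  then show ?case using Cons by simp
qed simp

text \<open>Exactly one shift index contributes: the difference of the two digit vectors, which lies
  in the range of summation.\<close>

lemma multilevel_toeplitz_entry:
  assumes "l < prod_list ns" "h < prod_list ns"
  shows "multilevel_toeplitz ns f $$ (l, h) =
    fourier_coeff (length ns) f (map2 (-) (digits ns l) (digits ns h))"
proof -
  let ?J = "{js. list_all2 (\<lambda>j m. \<bar>j\<bar> < int m) js ns}"
  let ?d = "map2 (-) (digits ns l) (digits ns h)"
  have "multilevel_toeplitz ns f $$ (l, h) =
      (\<Sum>js \<in> ?J. if js = ?d then fourier_coeff (length ns) f js else 0)"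
    unfolding multilevel_toeplitz_def using assms
    by (auto simp: kronecker_shift_entry list_all2_lengthD intro!: sum.cong)
  also have "\<dots> = fourier_coeff (length ns) f ?d"
    using digit_differences_bounded[OF assms] finite_shift_indices[of ns] by (simp add: sum.delta)
  finally show ?thesis .
qed

lemma digits_complement:
  assumes "l < prod_list ns"
  shows "digits ns (prod_list ns - 1 - l) = map2 (\<lambda>m k. int m - 1 - k) ns (digits ns l)"
  using assms
proof (induction ns arbitrary: l)
  case (Cons m ns)
  let ?q = "prod_list ns" and ?c = "m * prod_list ns - 1 - l"
  have l: "l < m * ?q" and c: "?c < m * ?q" using Cons.prems by auto
  have "l div ?q + ?c div ?q + 1 = m" "l mod ?q + ?c mod ?q + 1 = ?q"
    using mixed_radix_complement[OF l c] l by auto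
  then have "int (?c div ?q) = int m - 1 - int (l div ?q)" "?c mod ?q = ?q - 1 - l mod ?q"
    by auto
  then show ?case using Cons.IH[of "l mod ?q"] div_mod_less_factors[OF l] by simp
qed simp

text \<open>Entries depend only on digit differences, and these survive complementing all digits and
  exchanging row and column.\<close>

lemma multilevel_toeplitz_persymmetric:
  assumes l: "l < prod_list ns" and h: "h < prod_list ns"
  shows "multilevel_toeplitz ns f $$ (prod_list ns - 1 - h, prod_list ns - 1 - l) =
    multilevel_toeplitz ns f $$ (l, h)"
proof -
  have "map2 (-) (map2 (\<lambda>m k. int m - 1 - k) ns b) (map2 (\<lambda>m k. int m - 1 - k) ns a) = map2 (-) a b"
    if "length a = length ns" "length b = length ns" for a b
    using that by (intro nth_equalityI) auto
  moreover have "prod_list ns - 1 - h < prod_list ns" "prod_list ns - 1 - l < prod_list ns"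
    using l h by auto
  ultimately show ?thesis
    by (simp only: multilevel_toeplitz_entry l h digits_complement length_digits)
qed

subsection \<open>Quadratic forms of Toeplitz matrices\<close>

text \<open>The character of the torus whose frequency vector is \<open>digits ns l\<close>. The
  Toeplitz entry \<open>(l, h)\<close> integrates \<open>f\<close> against \<open>char_exp l\<close>
  times the conjugate of \<open>char_exp h\<close>.\<close>

definition char_exp :: "nat list \<Rightarrow> (nat \<Rightarrow> real) \<Rightarrow> nat \<Rightarrow> complex" where
  "char_exp ns \<theta> l = exp (\<i> * of_real (\<Sum>k<length ns. of_int (digits ns l ! k) * \<theta> k))"

lemma char_exp_mult_cnj:
  "char_exp ns \<theta> l * cnj (char_exp ns \<theta> h) =
    exp (\<i> * of_real (\<Sum>k<length ns. of_int (map2 (-) (digits ns l) (digits ns h) ! k) * \<theta> k))"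
  by (simp add: char_exp_def exp_cnj exp_add[symmetric] sum_subtractf algebra_simps)

lemma measurable_component_cube:
  assumes "k < d"
  shows "(\<lambda>\<theta>. \<theta> k) \<in> borel_measurable (cube_measure d)"
proof -
  have "(\<lambda>\<theta>. \<theta> k) \<in> borel_measurable (\<Pi>\<^sub>M i\<in>{..<d}. lborel :: real measure)"
    using measurable_component_singleton[of k "{..<d}" "\<lambda>_. lborel :: real measure"] assms by simp
  then show ?thesis
    unfolding cube_measure_def by (intro measurable_restrict_space1 measurable_completion)
qed

text \<open>The exponential has modulus one, so \<open>f\<close> itself is an integrable
  bound.\<close>

lemma integrable_mult_exp:
  fixes f :: "(nat \<Rightarrow> real) \<Rightarrow> complex"
  assumes f: "integrable (cube_measure d) f"
  shows "integrable (cube_measure d) (\<lambda>\<theta>. f \<theta> * exp (\<i> * of_real (\<Sum>k<d. a k * \<theta> k)))"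
proof (rule Bochner_Integration.integrable_bound[OF f])
  have "(\<lambda>\<theta>. \<Sum>k<d. a k * \<theta> k) \<in> borel_measurable (cube_measure d)"
    by (intro borel_measurable_sum borel_measurable_times) (auto intro: measurable_component_cube)
  then have "(\<lambda>\<theta>. exp (\<i> * complex_of_real (\<Sum>k<d. a k * \<theta> k))) \<in> borel_measurable (cube_measure d)"
    by measurable
  with f show "(\<lambda>\<theta>. f \<theta> * exp (\<i> * of_real (\<Sum>k<d. a k * \<theta> k))) \<in> borel_measurable (cube_measure d)"
    by (intro borel_measurable_times) auto
  show "AE \<theta> in cube_measure d. norm (f \<theta> * exp (\<i> * of_real (\<Sum>k<d. a k * \<theta> k))) \<le> norm (f \<theta>)"
    by (simp add: norm_mult)
qed

text \<open>Expanding the squared modulus of \<open>p\<close> as \<open>cnj p * p\<close> produces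
  the characters of the entries. The conjugates in \<open>p\<close> match the positive sign in the
  exponent of \<open>fourier_coeff\<close>.\<close>

lemma toeplitz_quadratic_form:
  fixes v :: "nat \<Rightarrow> complex"
  assumes f: "integrable (cube_measure (length ns)) f"
  defines "p \<equiv> \<lambda>\<theta>. \<Sum>h<prod_list ns. v h * cnj (char_exp ns \<theta> h)"
  shows "integrable (cube_measure (length ns)) (\<lambda>\<theta>. f \<theta> * of_real ((cmod (p \<theta>))\<^sup>2))"
    and "(\<Sum>l<prod_list ns. \<Sum>h<prod_list ns. cnj (v l) * v h * multilevel_toeplitz ns f $$ (l, h)) =
      1 / of_real ((2 * pi) ^ length ns) *
      (LINT \<theta>|cube_measure (length ns). f \<theta> * of_real ((cmod (p \<theta>))\<^sup>2))"
proof -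
  let ?n = "prod_list ns" and ?M = "cube_measure (length ns)"
  let ?e = "\<lambda>l h \<theta>. char_exp ns \<theta> l * cnj (char_exp ns \<theta> h)"
  have int: "integrable ?M (\<lambda>\<theta>. f \<theta> * ?e l h \<theta>)" for l h
    unfolding char_exp_mult_cnj by (rule integrable_mult_exp[OF f])
  have expand: "f \<theta> * of_real ((cmod (p \<theta>))\<^sup>2) =
      (\<Sum>l<?n. \<Sum>h<?n. cnj (v l) * v h * (f \<theta> * ?e l h \<theta>))" for \<theta>
  proof -
    have "of_real ((cmod (p \<theta>))\<^sup>2) = cnj (p \<theta>) * p \<theta>"
      by (simp only: complex_norm_square mult.commute)
    also have "\<dots> = (\<Sum>l<?n. \<Sum>h<?n. cnj (v l) * v h * ?e l h \<theta>)"
      unfolding p_def cnj_sum sum_product by (intro sum.cong refl) (simp add: ac_simps)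
    finally show ?thesis by (simp add: sum_distrib_left ac_simps)
  qed
  show "integrable ?M (\<lambda>\<theta>. f \<theta> * of_real ((cmod (p \<theta>))\<^sup>2))"
    unfolding expand by (intro Bochner_Integration.integrable_sum integrable_mult_right int)
  have "(LINT \<theta>|?M. f \<theta> * of_real ((cmod (p \<theta>))\<^sup>2)) =
      (\<Sum>l<?n. \<Sum>h<?n. cnj (v l) * v h * (LINT \<theta>|?M. f \<theta> * ?e l h \<theta>))"
    unfolding expand
    by (subst Bochner_Integration.integral_sum,
        intro Bochner_Integration.integrable_sum integrable_mult_right int)
      (simp add: Bochner_Integration.integral_sum integrable_mult_right int)
  then show "(\<Sum>l<?n. \<Sum>h<?n. cnj (v l) * v h * multilevel_toeplitz ns f $$ (l, h)) =
      1 / of_real ((2 * pi) ^ length ns) * (LINT \<theta>|?M. f \<theta> * of_real ((cmod (p \<theta>))\<^sup>2))"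
    by (simp add: multilevel_toeplitz_entry fourier_coeff_def char_exp_mult_cnj sum_distrib_left ac_simps)
qed

text \<open>The sector condition on \<open>f\<close> passes to the Hermitian form of
  \<open>T\<close> at \<open>x + \<i> y\<close>, since that form integrates \<open>f\<close> against
  a nonnegative weight. As \<open>T\<close> is real, the real and imaginary parts of the form are
  the two sides of the claim.\<close>

lemma toeplitz_numerical_range:
  assumes f: "integrable (cube_measure (length ns)) f"
    and M: "AE \<theta> in cube_measure (length ns). \<bar>Im (f \<theta>)\<bar> \<le> M * Re (f \<theta>)"
    and T: "multilevel_toeplitz ns f = map_mat complex_of_real T"
    and x: "x \<in> carrier_vec (prod_list ns)" and y: "y \<in> carrier_vec (prod_list ns)"
  shows "\<bar>bil T x y - bil T y x\<bar> \<le> M * (bil T x x + bil T y y)"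
proof -
  let ?n = "prod_list ns" and ?M = "cube_measure (length ns)"
  have "dim_row (multilevel_toeplitz ns f) = ?n" "dim_col (multilevel_toeplitz ns f) = ?n"
    by (simp_all add: multilevel_toeplitz_def)
  then have Tc: "T \<in> carrier_mat ?n ?n" unfolding T by auto
  define v where "v = (\<lambda>i. Complex (x $ i) (y $ i))"
  define p where "p = (\<lambda>\<theta>. \<Sum>h<?n. v h * cnj (char_exp ns \<theta> h))"
  define K where "K = 1 / (2 * pi) ^ length ns"
  have K: "0 \<le> K" by (simp add: K_def)
  let ?g = "\<lambda>\<theta>. f \<theta> * of_real ((cmod (p \<theta>))\<^sup>2)"
  define Q where "Q = (\<Sum>l<?n. \<Sum>h<?n. cnj (v l) * v h * multilevel_toeplitz ns f $$ (l, h))"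
  have int: "integrable ?M ?g" and Q: "Q = of_real K * (LINT \<theta>|?M. ?g \<theta>)"
    using toeplitz_quadratic_form[OF f, of v] unfolding p_def Q_def K_def by simp_all
  have ReQ: "Re Q = K * (LINT \<theta>|?M. Re (f \<theta>) * (cmod (p \<theta>))\<^sup>2)"
    and ImQ: "Im Q = K * (LINT \<theta>|?M. Im (f \<theta>) * (cmod (p \<theta>))\<^sup>2)"
    unfolding Q using integral_Re[OF int] integral_Im[OF int] by simp_all
  have ir: "integrable ?M (\<lambda>\<theta>. Re (f \<theta>) * (cmod (p \<theta>))\<^sup>2)"
    and ii: "integrable ?M (\<lambda>\<theta>. Im (f \<theta>) * (cmod (p \<theta>))\<^sup>2)"
    using integrable_Re[OF int] integrable_Im[OF int] by simp_all
  have "\<bar>LINT \<theta>|?M. Im (f \<theta>) * (cmod (p \<theta>))\<^sup>2\<bar> \<le> (LINT \<theta>|?M. \<bar>Im (f \<theta>) * (cmod (p \<theta>))\<^sup>2\<bar>)"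
    by (rule integral_abs_bound)
  also have "\<dots> \<le> (LINT \<theta>|?M. M * (Re (f \<theta>) * (cmod (p \<theta>))\<^sup>2))"
  proof (rule integral_mono_AE)
    show "AE \<theta> in ?M. \<bar>Im (f \<theta>) * (cmod (p \<theta>))\<^sup>2\<bar> \<le> M * (Re (f \<theta>) * (cmod (p \<theta>))\<^sup>2)"
      using M
    proof eventually_elim
      case (elim \<theta>)
      then show ?case
        using mult_right_mono[OF elim, of "(cmod (p \<theta>))\<^sup>2"] by (simp add: abs_mult mult.assoc)
    qed
  qed (use ir ii in auto)
  finally have "\<bar>Im Q\<bar> \<le> M * Re Q"
    unfolding ReQ ImQ using mult_left_mono[OF _ K] K by (fastforce simp: abs_mult mult.left_commute)
  moreover have "Re Q = bil T x x + bil T y y"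
  proof -
    have "Re Q = (\<Sum>l<?n. \<Sum>h<?n. x $ l * T $$ (l, h) * x $ h + y $ l * T $$ (l, h) * y $ h)"
      unfolding Q_def T v_def using Tc by (simp add: algebra_simps)
    then show ?thesis by (simp add: bil_sum[OF Tc] x y sum.distrib)
  qed
  moreover have "Im Q = bil T x y - bil T y x"
  proof -
    have "Im Q = (\<Sum>l<?n. \<Sum>h<?n. x $ l * T $$ (l, h) * y $ h - y $ l * T $$ (l, h) * x $ h)"
      unfolding Q_def T v_def using Tc by (simp add: algebra_simps)
    then show ?thesis by (simp add: bil_sum[OF Tc] x y sum_subtractf)
  qed
  ultimately show ?thesis by simp
qed

subsection \<open>The reversed pencil\<close>

text \<open>The bound on the skew form is a premise of the upper estimate alone, so the lower
  estimate remains available when the essential supremum is infinite.\<close>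

lemma reversed_pencil_bounds:
  fixes T P Y :: "real mat" and x :: "real vec" and c_min c_max M lam :: real
  defines "H \<equiv> sym_part T"
  assumes T: "T \<in> carrier_mat n n" and Y: "Y \<in> carrier_mat n n"
    and YY: "Y * Y = 1\<^sub>m n" and YT: "transpose_mat Y = Y" and pers: "Y * T * Y = transpose_mat T"
    and P: "sym_pos_def n P" and cmin: "0 < c_min"
    and lower: "\<And>v. v \<in> carrier_vec n \<Longrightarrow> c_min * bil P v v \<le> bil H v v"
    and upper: "\<And>v. v \<in> carrier_vec n \<Longrightarrow> bil H v v \<le> c_max * bil P v v"
    and x: "x \<in> carrier_vec n" "x \<noteq> 0\<^sub>v n"
    and ev: "Y *\<^sub>v (T *\<^sub>v x) = lam \<cdot>\<^sub>v (P *\<^sub>v x)"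
  shows "c_min \<le> \<bar>lam\<bar>"
    and "0 \<le> M \<Longrightarrow> (\<And>v w. v \<in> carrier_vec n \<Longrightarrow> w \<in> carrier_vec n \<Longrightarrow>
        \<bar>bil T v w - bil T w v\<bar> \<le> M * (bil T v v + bil T w w)) \<Longrightarrow>
      \<bar>lam\<bar> \<le> c_max * sqrt (1 + M\<^sup>2)"
proof -
  have Tt: "transpose_mat T \<in> carrier_mat n n" using T by simp
  have H: "H \<in> carrier_mat n n" "transpose_mat H = H"
    using T by (auto simp: H_def sym_part_def intro!: eq_matI)
  have Pc: "P \<in> carrier_mat n n" using P by (simp add: sym_pos_def_def)
  have bH: "bil H v w = (bil T v w + bil T w v) / 2" if "v \<in> carrier_vec n" "w \<in> carrier_vec n" for v w
    unfolding H_def sym_part_def using T Tt that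
    by (simp add: bil_smult_mat[of _ n, OF _ Tt] bil_add_mat[of _ n] bil_transpose[OF T T])
  have Ppos: "0 < bil P v v" if "v \<in> carrier_vec n" "v \<noteq> 0\<^sub>v n" for v
    using sym_pos_def_pos[OF P that] .
  have Pnn: "0 \<le> bil P v v" if "v \<in> carrier_vec n" for v
    using sym_pos_def_psd[OF P] that by (simp add: psd_def)
  have psdH: "psd n H"
    unfolding psd_def using H order_trans[OF mult_nonneg_nonneg[OF less_imp_le[OF cmin] Pnn] lower] by auto
  have injH: "v = 0\<^sub>v n" if v: "v \<in> carrier_vec n" "H *\<^sub>v v = 0\<^sub>v n" for v
  proof (rule ccontr)
    assume "v \<noteq> 0\<^sub>v n"
    then have "0 < c_min * bil P v v" using Ppos v cmin by simp
    also have "\<dots> \<le> bil H v v" using lower v by simp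
    finally show False using v by (simp add: bil_def)
  qed
  define S where "S = (1 / 2) \<cdot>\<^sub>m (T + (-1) \<cdot>\<^sub>m transpose_mat T)"
  have Sc: "S \<in> carrier_mat n n" using T by (simp add: S_def)
  have bS: "bil S v w = (bil T v w - bil T w v) / 2" if "v \<in> carrier_vec n" "w \<in> carrier_vec n" for v w
    unfolding S_def using T Tt that
    by (simp add: bil_smult_mat[of _ n, OF _ Tt] bil_add_mat[of _ n] bil_transpose[OF T T])
  \<comment> \<open>Solving \<open>H z = S x\<close> absorbs the skew part:
    \<open>T x = H x + S x\<close> becomes \<open>H (x + z)\<close>.\<close>
  have "S *\<^sub>v x \<in> carrier_vec n" using Sc x by simp
  then obtain z where z: "z \<in> carrier_vec n" "H *\<^sub>v z = S *\<^sub>v x"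
    using injective_mat_solve[OF H(1) injH] by blast
  define u where "u = Y *\<^sub>v (x + z)"
  have u: "u \<in> carrier_vec n" using Y x z by (simp add: u_def)
  \<comment> \<open>Multiplying \<open>Y T Y = T^t\<close> by the involution \<open>Y\<close>
    exchanges \<open>T\<close> and its transpose across \<open>Y\<close>. The two resulting
    identities make \<open>Y\<close> commute with \<open>H\<close>.\<close>
  have TY: "T * Y = Y * transpose_mat T"
  proof -
    have "Y * transpose_mat T = Y * (Y * (T * Y))" using pers T Y by (simp add: assoc_mult_mat[of _ n n _ n _ n])
    also have "\<dots> = (Y * Y) * (T * Y)" using T Y by (simp add: assoc_mult_mat[of _ n n _ n _ n])
    finally show ?thesis using T Y by (simp add: YY)
  qed
  have TY': "transpose_mat T * Y = Y * T"
    using TY pers T Y YY by (metis assoc_mult_mat left_mult_one_mat mult_carrier_mat right_mult_one_mat)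
  have TT: "T + transpose_mat T \<in> carrier_mat n n" using T Tt by simp
  have HY: "H * Y = Y * H"
    using T Y TY TY' by (simp add: H_def sym_part_def mult_smult_assoc_mat[OF TT Y]
        mult_smult_distrib[OF Y TT] add_mult_distrib_mat[of _ n n] mult_add_distrib_mat[of _ n n] comm_add_mat[of _ n n])
  have Tx: "T *\<^sub>v x = H *\<^sub>v (x + z)"
  proof -
    have "T = H + S" using T by (auto simp: H_def S_def sym_part_def field_simps intro!: eq_matI)
    then have "T *\<^sub>v x = H *\<^sub>v x + S *\<^sub>v x"
      using add_mult_distrib_mat_vec[OF H(1) Sc x(1)] by simp
    then show ?thesis using H x z by (simp add: mult_add_distrib_mat_vec[of _ n n])
  qed
  have Hu: "H *\<^sub>v u = lam \<cdot>\<^sub>v (P *\<^sub>v x)"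
  proof -
    have "H *\<^sub>v u = (H * Y) *\<^sub>v (x + z)" unfolding u_def using H Y x z by (simp add: assoc_mult_mat_vec[of _ n n])
    also have "\<dots> = Y *\<^sub>v (H *\<^sub>v (x + z))" unfolding HY using H Y x z by (simp add: assoc_mult_mat_vec[of _ n n])
    finally show ?thesis by (simp add: Tx[symmetric] ev)
  qed
  have bHu: "bil H w u = lam * bil P w x" if "w \<in> carrier_vec n" for w
    unfolding bil_def Hu using that Pc x by simp
  have xz: "x + z \<in> carrier_vec n" using x z by simp
  \<comment> \<open>\<open>Y\<close> is symmetric and involutory, hence orthogonal, and commutes
    with \<open>H\<close>; it therefore preserves the form of \<open>H\<close>.\<close>
  have "bil H u u = bil H (x + z) (x + z)"
  proof -
    have "bil H u u = scalar_prod (Y *\<^sub>v (x + z)) (Y *\<^sub>v (H *\<^sub>v (x + z)))"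
      unfolding bil_def Hu u_def[symmetric] by (simp add: Tx[symmetric] ev)
    also have "\<dots> = scalar_prod (x + z) (Y *\<^sub>v (Y *\<^sub>v (H *\<^sub>v (x + z))))"
      using bil_transpose[OF Y Y, of "x + z" "Y *\<^sub>v (H *\<^sub>v (x + z))"] xz H Y YT
        comm_scalar_prod[of "Y *\<^sub>v (x + z)" n "Y *\<^sub>v (H *\<^sub>v (x + z))"]
      by (simp add: bil_def)
    also have "Y *\<^sub>v (Y *\<^sub>v (H *\<^sub>v (x + z))) = H *\<^sub>v (x + z)"
      using YY Y H xz by (metis assoc_mult_mat_vec mult_mat_vec_carrier one_mult_mat_vec)
    finally show ?thesis by (simp add: bil_def)
  qed
  also have "\<dots> = bil H x x + 2 * bil H x z + bil H z z"
    using bil_add_smult[OF H x(1) z(1), of 1] by simp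
  \<comment> \<open>The cross term is \<open>bil S x x\<close>, which vanishes by skew
    symmetry.\<close>
  also have "bil H x z = 0" using bS[OF x(1) x(1)] z(2) by (simp add: bil_def)
  finally have uu: "bil H u u = bil H x x + bil H z z" by simp
  have zz: "0 \<le> bil H z z" "0 \<le> bil H x x" "0 \<le> bil H u u" using psdH z x u by (auto simp: psd_def)
  let ?p = "bil P x x"
  have p: "0 < ?p" using Ppos x by simp
  \<comment> \<open>Cauchy-Schwarz for \<open>P\<close> bounds \<open>bil P u x\<close>, the lower
    bound on \<open>H\<close> replaces \<open>bil P u u\<close> by \<open>bil H u u\<close>, and one
    factor \<open>bil H u u\<close> cancels. Then
    \<open>c_min * bil P x x \<le> bil H x x \<le> bil H u u\<close> finishes.\<close>
  show "c_min \<le> \<bar>lam\<bar>"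
  proof -
    have cs: "(bil P u x)\<^sup>2 \<le> bil P u u * ?p"
      using psd_Cauchy_Schwarz[OF sym_pos_def_psd[OF P] u x(1)] .
    have hu: "bil H u u = lam * bil P u x" using bHu[OF u] .
    have pos: "0 < bil H u u"
      using uu zz lower[OF x(1)] p cmin by (smt (verit) mult_pos_pos)
    have "c_min * (bil H u u)\<^sup>2 = lam\<^sup>2 * (c_min * (bil P u x)\<^sup>2)" by (simp add: hu power_mult_distrib)
    also have "\<dots> \<le> lam\<^sup>2 * (c_min * (bil P u u * ?p))"
      using cs cmin by (intro mult_left_mono) auto
    also have "\<dots> = lam\<^sup>2 * ?p * (c_min * bil P u u)" by simp
    also have "\<dots> \<le> lam\<^sup>2 * ?p * bil H u u" using lower[OF u] p by (intro mult_left_mono) auto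
    finally have "c_min * bil H u u \<le> lam\<^sup>2 * ?p" using pos by (simp add: power2_eq_square)
    moreover have "c_min * (c_min * ?p) \<le> c_min * bil H u u"
      using uu zz lower[OF x(1)] cmin by (intro mult_left_mono) auto
    ultimately have "c_min\<^sup>2 * ?p \<le> lam\<^sup>2 * ?p" by (simp add: power2_eq_square)
    then have "c_min\<^sup>2 \<le> lam\<^sup>2" using p by simp
    then have "c_min\<^sup>2 \<le> \<bar>lam\<bar>\<^sup>2" by simp
    then show ?thesis by (rule power2_le_imp_le) simp
  qed
  assume M: "0 \<le> M"
    and skew: "\<And>v w. v \<in> carrier_vec n \<Longrightarrow> w \<in> carrier_vec n \<Longrightarrow>
        \<bar>bil T v w - bil T w v\<bar> \<le> M * (bil T v v + bil T w w)"
  have zSx: "bil H z z = bil S z x" using z(2) by (simp add: bil_def)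
  \<comment> \<open>The skew bound is applied to \<open>s z\<close> and \<open>x\<close>. The later
    choice \<open>s = 1 / M\<close> maximises \<open>2 * s - M * s^2\<close> and yields the factor
    \<open>M^2\<close>; for \<open>M = 0\<close> any positive \<open>s\<close> works.\<close>
  have scaled: "2 * s * bil H z z \<le> M * (s\<^sup>2 * bil H z z + bil H x x)" for s
  proof -
    have sz: "s \<cdot>\<^sub>v z \<in> carrier_vec n" using z by simp
    have "bil T (s \<cdot>\<^sub>v z) x - bil T x (s \<cdot>\<^sub>v z) = 2 * s * bil H z z"
      using bS[OF z(1) x(1), THEN arg_cong, of "\<lambda>r. 2 * s * r"] z x T by (simp add: zSx bil_smult_left[of _ n] bil_smult_right[of _ n] algebra_simps)
    moreover have "bil T (s \<cdot>\<^sub>v z) (s \<cdot>\<^sub>v z) = s\<^sup>2 * bil H z z"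
      using bH[OF z(1) z(1)] z sz T
      by (simp add: bil_smult_left[of _ n] bil_smult_right[of _ n] power2_eq_square)
    moreover have "bil T x x = bil H x x" using bH[OF x(1) x(1)] by simp
    ultimately show ?thesis using skew[OF sz x(1)] by simp
  qed
  have hz: "bil H z z \<le> M\<^sup>2 * bil H x x"
  proof (cases "M = 0")
    case True
    then show ?thesis using scaled[of 1] by simp
  next
    case False
    then show ?thesis using M scaled[of "1 / M"] by (simp add: field_simps power2_eq_square)
  qed
  \<comment> \<open>Here \<open>lam * bil P x x\<close> is \<open>bil H x u\<close>, so
    Cauchy-Schwarz for \<open>H\<close> applies.\<close>
  have "(lam * ?p)\<^sup>2 \<le> (1 + M\<^sup>2) * (bil H x x)\<^sup>2"
  proof -
    have "(lam * ?p)\<^sup>2 \<le> bil H x x * bil H u u"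
      using psd_Cauchy_Schwarz[OF psdH x(1) u] bHu[OF x(1)] by simp
    also have "\<dots> \<le> bil H x x * ((1 + M\<^sup>2) * bil H x x)"
      using uu hz zz by (intro mult_left_mono) (auto simp: algebra_simps)
    finally show ?thesis by (simp add: power2_eq_square ac_simps)
  qed
  then have "\<bar>lam * ?p\<bar> \<le> sqrt (1 + M\<^sup>2) * bil H x x"
    using zz real_sqrt_le_mono by (fastforce simp: real_sqrt_mult)
  also have "\<dots> \<le> sqrt (1 + M\<^sup>2) * (c_max * ?p)"
    using upper[OF x(1)] by (intro mult_left_mono) auto
  finally show "\<bar>lam\<bar> \<le> c_max * sqrt (1 + M\<^sup>2)"
    using p by (simp add: abs_mult ac_simps)
qed

text \<open>The product of the inverse of \<open>P\<close> with a symmetric \<open>A\<close> is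
  self-adjoint for the inner product of \<open>P\<close>, so its complex eigenvalues are real and
  have real eigenvectors.\<close>

lemma complex_spectrum_iff:
  assumes P: "sym_pos_def n P" and A: "A \<in> carrier_mat n n" "transpose_mat A = A"
  shows "complex_spectrum (inverse_mat P * A) =
    complex_of_real ` {t. \<exists>x \<in> carrier_vec n. x \<noteq> 0\<^sub>v n \<and> A *\<^sub>v x = t \<cdot>\<^sub>v (P *\<^sub>v x)}"
    (is "_ = complex_of_real ` ?E")
proof -
  let ?B = "inverse_mat P" and ?c = complex_of_real
  have Pc: "P \<in> carrier_mat n n" "transpose_mat P = P" using P by (auto simp: sym_pos_def_def)
  have B: "?B \<in> carrier_mat n n" "P * ?B = 1\<^sub>m n" "?B * P = 1\<^sub>m n"
    using injective_mat_inverse[OF Pc(1) sym_pos_def_inj[OF P]] by (simp_all add: inverse_mat_def)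
  have BA: "?B * A \<in> carrier_mat n n" using B A by simp
  show ?thesis
  proof (intro Set.set_eqI iffI)
    fix k assume "k \<in> ?c ` ?E"
    then obtain t x where k: "k = ?c t" and x: "x \<in> carrier_vec n" "x \<noteq> 0\<^sub>v n"
      and e: "A *\<^sub>v x = t \<cdot>\<^sub>v (P *\<^sub>v x)" by auto
    have "(?B * A) *\<^sub>v x = ?B *\<^sub>v (t \<cdot>\<^sub>v (P *\<^sub>v x))"
      using B A x by (simp add: assoc_mult_mat_vec[of _ n n] e)
    also have "\<dots> = t \<cdot>\<^sub>v (?B *\<^sub>v (P *\<^sub>v x))"
      using B Pc x by (simp add: mult_mat_vec[of _ n n])
    also have "?B *\<^sub>v (P *\<^sub>v x) = x"
      using B Pc x by (metis assoc_mult_mat_vec one_mult_mat_vec)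
    finally have "(?B * A) *\<^sub>v x = t \<cdot>\<^sub>v x" .
    then have "eigenvector (?B * A) x t"
      using x BA by (auto simp: eigenvector_def)
    then have "eigenvalue (?B * A) t" by (auto simp: eigenvalue_def)
    then show "k \<in> complex_spectrum (?B * A)"
      using of_real_hom.eigenvalue_hom[OF BA, of t] k by (simp add: complex_spectrum_def spectrum_def)
  next
    fix k assume "k \<in> complex_spectrum (?B * A)"
    then obtain v where v: "v \<in> carrier_vec n" "v \<noteq> 0\<^sub>v n"
      and e: "map_mat ?c (?B * A) *\<^sub>v v = k \<cdot>\<^sub>v v"
      using BA by (auto simp: complex_spectrum_def spectrum_def eigenvalue_def eigenvector_def)
    have mh: "map_mat ?c (X * Z) = map_mat ?c X * map_mat ?c Z"
      if "X \<in> carrier_mat n n" "Z \<in> carrier_mat n n" for X Z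
      using of_real_hom.mat_hom_mult[OF that] .
    have "map_mat ?c A *\<^sub>v v = map_mat ?c (P * (?B * A)) *\<^sub>v v"
      using B A Pc by (simp flip: assoc_mult_mat[of _ n n _ n _ n])
    also have "\<dots> = map_mat ?c P *\<^sub>v (k \<cdot>\<^sub>v v)"
      using BA Pc v by (simp add: mh assoc_mult_mat_vec[of _ n n] e del: assoc_mult_mat)
    finally have ev: "map_mat ?c A *\<^sub>v v = k \<cdot>\<^sub>v (map_mat ?c P *\<^sub>v v)"
      using Pc v by (simp add: mult_mat_vec[of _ n n])
    define a b where "a = map_vec Re v" and "b = map_vec Im v"
    have ab: "a \<in> carrier_vec n" "b \<in> carrier_vec n" using v by (auto simp: a_def b_def)
    have parts: "Re ((map_mat ?c X *\<^sub>v v) $ i) = (X *\<^sub>v a) $ i"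
      "Im ((map_mat ?c X *\<^sub>v v) $ i) = (X *\<^sub>v b) $ i"
      if "X \<in> carrier_mat n n" "i < n" for X i
      using that v by (auto simp: scalar_prod_def a_def b_def)
    have Aa: "A *\<^sub>v a = Re k \<cdot>\<^sub>v (P *\<^sub>v a) + (- Im k) \<cdot>\<^sub>v (P *\<^sub>v b)"
    proof (rule eq_vecI)
      fix i assume "i < dim_vec (Re k \<cdot>\<^sub>v (P *\<^sub>v a) + (- Im k) \<cdot>\<^sub>v (P *\<^sub>v b))"
      then have i: "i < n" using Pc by simp
      have "(A *\<^sub>v a) $ i = Re ((k \<cdot>\<^sub>v (map_mat ?c P *\<^sub>v v)) $ i)"
        using parts(1)[OF A(1) i] ev by simp
      also have "\<dots> = Re (k * (map_mat ?c P *\<^sub>v v) $ i)" using i Pc by simp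
      finally show "(A *\<^sub>v a) $ i = (Re k \<cdot>\<^sub>v (P *\<^sub>v a) + (- Im k) \<cdot>\<^sub>v (P *\<^sub>v b)) $ i"
        using parts[OF Pc(1) i] i Pc by (simp only: times_complex.sel) simp
    qed (use A Pc in auto)
    have Ab: "A *\<^sub>v b = Re k \<cdot>\<^sub>v (P *\<^sub>v b) + Im k \<cdot>\<^sub>v (P *\<^sub>v a)"
    proof (rule eq_vecI)
      fix i assume "i < dim_vec (Re k \<cdot>\<^sub>v (P *\<^sub>v b) + Im k \<cdot>\<^sub>v (P *\<^sub>v a))"
      then have i: "i < n" using Pc by simp
      have "(A *\<^sub>v b) $ i = Im ((k \<cdot>\<^sub>v (map_mat ?c P *\<^sub>v v)) $ i)"
        using parts(2)[OF A(1) i] ev by simp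
      also have "\<dots> = Im (k * (map_mat ?c P *\<^sub>v v) $ i)" using i Pc by simp
      finally show "(A *\<^sub>v b) $ i = (Re k \<cdot>\<^sub>v (P *\<^sub>v b) + Im k \<cdot>\<^sub>v (P *\<^sub>v a)) $ i"
        using parts[OF Pc(1) i] i Pc by (simp only: times_complex.sel) simp
    qed (use A Pc in auto)
    have Pv: "P *\<^sub>v a \<in> carrier_vec n" "P *\<^sub>v b \<in> carrier_vec n" using Pc ab by auto
    \<comment> \<open>Pairing the equation for the real part \<open>a\<close> with \<open>b\<close>,
      and that for \<open>b\<close> with \<open>a\<close>, gives equal left sides by symmetry. Their
      difference isolates \<open>Im k\<close>.\<close>
    have "bil A b a = Re k * bil P b a - Im k * bil P b b"
      unfolding bil_def Aa using ab Pv by (simp add: scalar_prod_add_distrib[of _ n])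
    moreover have "bil A a b = Re k * bil P a b + Im k * bil P a a"
      unfolding bil_def Ab using ab Pv by (simp add: scalar_prod_add_distrib[of _ n])
    ultimately have im: "Im k * (bil P a a + bil P b b) = 0"
      using bil_commute[OF A ab] bil_commute[OF Pc ab] by (simp add: algebra_simps)
    have nz: "a \<noteq> 0\<^sub>v n \<or> b \<noteq> 0\<^sub>v n"
    proof (rule ccontr)
      assume "\<not> ?thesis"
      then have z: "a $ i = 0" "b $ i = 0" if "i < n" for i using that by auto
      have "v = 0\<^sub>v n"
      proof (rule eq_vecI)
        fix i assume "i < dim_vec (0\<^sub>v n :: complex vec)"
        then show "v $ i = 0\<^sub>v n $ i" using z[of i] v by (simp add: a_def b_def complex_eq_iff)
      qed (use v in simp)
      with v show False by simp
    qed
    have "0 \<le> bil P a a" "0 \<le> bil P b b" using sym_pos_def_psd[OF P] ab by (auto simp: psd_def)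
    moreover have "0 < bil P a a \<or> 0 < bil P b b" using nz sym_pos_def_pos[OF P] ab by auto
    ultimately have "bil P a a + bil P b b > 0" by linarith
    with im have im0: "Im k = 0" by simp
    \<comment> \<open>With \<open>k\<close> real, both parts of \<open>v\<close> solve the real
      problem; whichever is nonzero is the eigenvector sought.\<close>
    have "A *\<^sub>v a = Re k \<cdot>\<^sub>v (P *\<^sub>v a)" "A *\<^sub>v b = Re k \<cdot>\<^sub>v (P *\<^sub>v b)"
      using Aa Ab Pv unfolding im0 by (auto intro!: eq_vecI simp: Pc)
    with nz ab have "Re k \<in> ?E" by blast
    moreover have "k = ?c (Re k)" using im0 by (simp add: complex_eq_iff)
    ultimately show "k \<in> ?c ` ?E" by (rule rev_image_eqI)
  qed
qed

section \<open>The anti-identity and Toeplitz reversal\<close>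

lemma anti_identity_mult:
  fixes A :: "'a :: semiring_1 mat"
  assumes "A \<in> carrier_mat n n" "i < n" "j < n"
  shows "(anti_identity n * A) $$ (i, j) = A $$ (n - 1 - i, j)"
    and "(A * anti_identity n) $$ (i, j) = A $$ (i, n - 1 - j)"
proof -
  have "(anti_identity n * A) $$ (i, j) = (\<Sum>k<n. (if i + k + 1 = n then 1 else 0) * A $$ (k, j))"
    using assms by (simp add: anti_identity_def scalar_prod_def lessThan_atLeast0)
  also have "\<dots> = (\<Sum>k<n. if k = n - 1 - i then A $$ (k, j) else 0)"
    using assms by (intro sum.cong) auto
  also have "\<dots> = A $$ (n - 1 - i, j)" using assms by (simp add: sum.delta)
  finally show "(anti_identity n * A) $$ (i, j) = A $$ (n - 1 - i, j)" .
  have "(A * anti_identity n) $$ (i, j) = (\<Sum>k<n. A $$ (i, k) * (if k + j + 1 = n then 1 else 0))"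
    using assms by (simp add: anti_identity_def scalar_prod_def lessThan_atLeast0)
  also have "\<dots> = (\<Sum>k<n. if k = n - 1 - j then A $$ (i, k) else 0)"
    using assms by (intro sum.cong) auto
  also have "\<dots> = A $$ (i, n - 1 - j)" using assms by (simp add: sum.delta)
  finally show "(A * anti_identity n) $$ (i, j) = A $$ (i, n - 1 - j)" .
qed

lemma anti_identity_carrier: "anti_identity n \<in> carrier_mat n n"
  by (simp add: anti_identity_def)

lemma anti_identity_transpose: "transpose_mat (anti_identity n) = anti_identity n"
  by (rule eq_matI) (auto simp: anti_identity_def add.commute)

lemma anti_identity_square: "anti_identity n * anti_identity n = (1\<^sub>m n :: 'a :: semiring_1 mat)"
proof (rule eq_matI)
  fix i j assume ij: "i < dim_row (1\<^sub>m n :: 'a mat)" "j < dim_col (1\<^sub>m n :: 'a mat)"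
  then show "(anti_identity n * anti_identity n) $$ (i, j) = (1\<^sub>m n :: 'a mat) $$ (i, j)"
    by (simp add: anti_identity_mult(1)[OF anti_identity_carrier]) (auto simp: anti_identity_def)
qed (auto simp: anti_identity_def)

text \<open>Multiplication by the anti-identity on both sides reverses both indices, so this is
  persymmetry read in \<open>T\<close> through the injective embedding of the reals.\<close>

lemma toeplitz_reversal:
  assumes T: "multilevel_toeplitz ns f = map_mat complex_of_real T"
  shows "anti_identity (prod_list ns) * T * anti_identity (prod_list ns) = transpose_mat T"
proof -
  let ?n = "prod_list ns"
  have "dim_row (multilevel_toeplitz ns f) = ?n" "dim_col (multilevel_toeplitz ns f) = ?n"
    by (simp_all add: multilevel_toeplitz_def)
  then have Tc: "T \<in> carrier_mat ?n ?n" unfolding T by auto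
  have YT: "anti_identity ?n * T \<in> carrier_mat ?n ?n" using anti_identity_carrier Tc by (rule mult_carrier_mat)
  show ?thesis
  proof (rule eq_matI)
    fix i j assume "i < dim_row (transpose_mat T)" "j < dim_col (transpose_mat T)"
    then have ij: "i < ?n" "j < ?n" using Tc by auto
    have "complex_of_real (T $$ (?n - 1 - i, ?n - 1 - j)) = complex_of_real (T $$ (j, i))"
      using multilevel_toeplitz_persymmetric[OF ij(2,1), of f] ij Tc unfolding T by simp
    then show "(anti_identity ?n * T * anti_identity ?n) $$ (i, j) = transpose_mat T $$ (i, j)"
      using ij Tc by (simp add: anti_identity_mult(2)[OF YT] anti_identity_mult(1)[OF Tc] )
  qed (use Tc YT carrier_matD[OF anti_identity_carrier[of ?n]] in auto)
qed

section \<open>Eigenvalue bounds for the preconditioned reversed Toeplitz matrix\<close>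

theorem theorem4p1:
  fixes d :: nat
    and ns :: "nat list"
    and f :: "(nat \<Rightarrow> real) \<Rightarrow> complex"
    and T P :: "real mat"
    and c_min c_max :: real
  assumes "0 < d"
    and "length ns = d"
    and "\<forall>m \<in> set ns. 0 < m"
    and "integrable (cube_measure d) f"
    and "AE \<theta> in cube_measure d. 0 < Re (f \<theta>)"
    and "multilevel_toeplitz ns f = map_mat complex_of_real T"
    and "sym_pos_def (prod_list ns) P"
    and "0 < c_min"
    and "0 < c_max"
    and "complex_spectrum (inverse_mat P * sym_part T) \<subseteq> complex_of_real ` {c_min..c_max}"
  shows "\<exists>\<epsilon>::real.
    (ereal \<epsilon> < esssup (cube_measure d) (\<lambda>\<theta>. ereal \<bar>Im (f \<theta>) / Re (f \<theta>)\<bar>)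
       \<or> (AE \<theta> in cube_measure d. Im (f \<theta>) = 0) \<and> \<epsilon> = 0) \<and>
    complex_spectrum (inverse_mat P * (multilevel_anti_identity ns * T))
      \<subseteq> complex_of_real ` ({- c_max * (1 + \<epsilon>) .. - c_min} \<union> {c_min .. c_max * (1 + \<epsilon>)})"
proof -
  let ?n = "prod_list ns" and ?M = "cube_measure d"
  let ?Y = "anti_identity (prod_list ns) :: real mat"
  note P = assms(7)
  note T = assms(6)
  have "dim_row (multilevel_toeplitz ns f) = ?n" "dim_col (multilevel_toeplitz ns f) = ?n"
    by (simp_all add: multilevel_toeplitz_def)
  then have Tc: "T \<in> carrier_mat ?n ?n" unfolding T by auto
  have Pc: "P \<in> carrier_mat ?n ?n" using P by (simp add: sym_pos_def_def)
  have Y: "?Y \<in> carrier_mat ?n ?n" by (rule anti_identity_carrier)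
  have YT: "?Y * T \<in> carrier_mat ?n ?n" using Y Tc by simp
  have H: "sym_part T \<in> carrier_mat ?n ?n" "transpose_mat (sym_part T) = sym_part T"
    using Tc by (auto simp: sym_part_def intro!: eq_matI)
  \<comment> \<open>Symmetry of \<open>Y T\<close> makes the preconditioned spectrum real and
    reduces it to a real pencil.\<close>
  have "transpose_mat (?Y * T) = ?Y * T * ?Y * ?Y"
    using transpose_mult[OF Y Tc] toeplitz_reversal[OF T] by (simp add: anti_identity_transpose)
  also have "\<dots> = ?Y * T" using YT Y by (simp add: assoc_mult_mat[of _ ?n ?n _ ?n _ ?n] anti_identity_square right_mult_one_mat[OF YT])
  finally have YTsym: "transpose_mat (?Y * T) = ?Y * T" .
  have pencil: "x = 0\<^sub>v ?n" if "t < c_min \<or> c_max < t" "x \<in> carrier_vec ?n"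
    "sym_part T *\<^sub>v x = t \<cdot>\<^sub>v (P *\<^sub>v x)" for t x
  proof (rule ccontr)
    assume "x \<noteq> 0\<^sub>v ?n"
    with that have "complex_of_real t \<in> complex_spectrum (inverse_mat P * sym_part T)"
      unfolding complex_spectrum_iff[OF P H] by blast
    with assms(10) that(1) show False by auto
  qed
  have lower: "c_min * bil P v v \<le> bil (sym_part T) v v" if "v \<in> carrier_vec ?n" for v
    using pencil by (intro pencil_lower_bound[OF H P _ that]) auto
  have upper: "bil (sym_part T) v v \<le> c_max * bil P v v" if "v \<in> carrier_vec ?n" for v
    using pencil by (intro pencil_upper_bound[OF H P _ that]) auto
  define E where "E = {t. \<exists>x \<in> carrier_vec ?n. x \<noteq> 0\<^sub>v ?n \<and> (?Y * T) *\<^sub>v x = t \<cdot>\<^sub>v (P *\<^sub>v x)}"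
  have spec: "complex_spectrum (inverse_mat P * (multilevel_anti_identity ns * T)) = complex_of_real ` E"
    unfolding multilevel_anti_identity_eq E_def by (rule complex_spectrum_iff[OF P YT YTsym])
  note bounds = reversed_pencil_bounds[OF Tc Y anti_identity_square anti_identity_transpose
      toeplitz_reversal[OF T] P assms(8) lower upper]
  have E_lower: "c_min \<le> \<bar>t\<bar>" if "t \<in> E" for t
    using that Y Tc by (auto simp: E_def assoc_mult_mat_vec[of _ ?n ?n] intro: bounds(1))
  have E_upper: "\<bar>t\<bar> \<le> c_max * sqrt (1 + r\<^sup>2)"
    if r: "0 \<le> r" "AE \<theta> in ?M. \<bar>Im (f \<theta>)\<bar> \<le> r * Re (f \<theta>)" and t: "t \<in> E" for r t
  proof -
    obtain x where x: "x \<in> carrier_vec ?n" "x \<noteq> 0\<^sub>v ?n" "?Y *\<^sub>v (T *\<^sub>v x) = t \<cdot>\<^sub>v (P *\<^sub>v x)"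
      using t Y Tc by (auto simp: E_def assoc_mult_mat_vec[of _ ?n ?n])
    show ?thesis
      using toeplitz_numerical_range[of ns f r T] assms(2,4) T r
      by (intro bounds(2)[OF _ _ x]) auto
  qed
  have conclude: "complex_of_real ` E
      \<subseteq> complex_of_real ` ({- c_max * (1 + e) .. - c_min} \<union> {c_min .. c_max * (1 + e)})"
    if "\<And>t. t \<in> E \<Longrightarrow> \<bar>t\<bar> \<le> c_max * (1 + e)" for e
  proof (intro image_mono subsetI)
    fix t assume "t \<in> E"
    with that[of t] E_lower[of t] show "t \<in> {- c_max * (1 + e) .. - c_min} \<union> {c_min .. c_max * (1 + e)}"
      by (auto simp: abs_if split: if_splits)
  qed
  let ?s = "esssup ?M (\<lambda>\<theta>. ereal \<bar>Im (f \<theta>) / Re (f \<theta>)\<bar>)"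
  \<comment> \<open>Positivity of \<open>Re f\<close> almost everywhere allows the denominator to be
    cleared.\<close>
  have ratio: "AE \<theta> in ?M. \<bar>Im (f \<theta>)\<bar> \<le> r * Re (f \<theta>)" if "?s \<le> ereal r" for r
    using esssup_AE[where M = ?M and f = "\<lambda>\<theta>. ereal \<bar>Im (f \<theta>) / Re (f \<theta>)\<bar>"] assms(5)
  proof eventually_elim
    case (elim \<theta>)
    then have "ereal \<bar>Im (f \<theta>) / Re (f \<theta>)\<bar> \<le> ereal r" using that by (meson order_trans)
    with elim show ?case by (simp add: abs_divide field_simps)
  qed
  \<comment> \<open>The last case gathers \<open>-\<infinity>\<close> and all nonpositive real
    values. There \<open>Im f\<close> vanishes almost everywhere and \<open>\<epsilon> = 0\<close>
    meets the second alternative.\<close>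
  consider (infinite) "?s = \<infinity>" | (pos) r where "0 < r" "?s = ereal r" | (zero) "?s \<le> ereal 0"
  proof (cases ?s)
    case (real r)
    then show ?thesis using that(2)[of r] that(3) by (cases "0 < r") auto
  qed (use that in simp_all)
  then show ?thesis
  proof cases
    case infinite
    have "finite (complex_of_real ` E)"
      unfolding spec[symmetric] complex_spectrum_def multilevel_anti_identity_eq
      using injective_mat_inverse(1)[OF Pc sym_pos_def_inj[OF P]] YT
      by (intro card_finite_spectrum(1)[of _ ?n]) (simp add: inverse_mat_def)
    then have "finite E" by (simp add: finite_image_iff inj_on_def)
    \<comment> \<open>Any finite \<open>e\<close> lies below the infinite supremum. This one gives
      \<open>c_max * (1 + e) = c_max + (\<Sum>t\<in>E. \<bar>t\<bar>)\<close>, which dominates every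
      eigenvalue.\<close>
    define e where "e = (\<Sum>t\<in>E. \<bar>t\<bar>) / c_max"
    have "c_max * (1 + e) = c_max + (\<Sum>t\<in>E. \<bar>t\<bar>)" using assms(9) by (simp add: e_def distrib_left)
    then have "\<bar>t\<bar> \<le> c_max * (1 + e)" if "t \<in> E" for t
      using member_le_sum[of t E abs] \<open>finite E\<close> that assms(9) by simp
    with conclude[of e] infinite spec show ?thesis by (intro exI[of _ e]) auto
  next
    case (pos r)
    \<comment> \<open>Chosen so that \<open>1 + e\<close> is exactly the factor
      \<open>sqrt (1 + r^2)\<close> of the upper estimate. Positivity of \<open>r\<close> makes
      \<open>e < r\<close> strict.\<close>
    define e where "e = sqrt (1 + r\<^sup>2) - 1"
    have "sqrt (1 + r\<^sup>2) < 1 + r"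
      using pos(1) by (intro real_less_lsqrt) (auto simp: power2_eq_square algebra_simps)
    then have "ereal e < ?s" using pos by (simp add: e_def)
    moreover have "\<bar>t\<bar> \<le> c_max * (1 + e)" if "t \<in> E" for t
      using E_upper[OF _ ratio that, of r] pos by (simp add: e_def)
    ultimately show ?thesis using conclude[of e] spec by (intro exI[of _ e]) auto
  next
    case zero
    have "AE \<theta> in ?M. Im (f \<theta>) = 0" using ratio[OF zero] by simp
    moreover have "\<bar>t\<bar> \<le> c_max * (1 + 0)" if "t \<in> E" for t
      using E_upper[OF _ ratio[OF zero] that] by simp
    ultimately show ?thesis using conclude[of 0] spec by (intro exI[of _ 0]) auto
  qed
qed

end
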